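(* Let $k\geqslant 3$ be an integer and let $A=\{0=a_{0}<a_{1}<\cdots<a_{k-1}\}$ be a set of $k$ integers such that $a_{i}<2i$ for all $i=1,\ldots,k-2$, $a_{k-1}\geqslant 2k-2$ and $\gcd(A)=1$. Then $$|2^{\wedge}A|\geqslant 3k-7.$$ Moreover, $|2^{\wedge}A|=3k-7$ if and only if $k\geqslant 6$ and one of the following cases holds: (1) $k\equiv 0\pmod{3}$ and $$A=\left([0,k-3]\cap 3\mathbb{Z}\right)\cup \left([1,2k-2]\cap (3\mathbb{Z}+1)\right);$$ (2) $k\equiv 1\pmod{3}$ and $$A=\left([0,2k-2]\cap 3\mathbb{Z}\right)\cup \left([1,k-3]\cap (3\mathbb{Z}+1)\right).$$
   Context: For a set $A$ of integers, $2^{\wedge}A=\{a+b: a,b\in A,\ a\neq b\}$ is the set of all sums of two distinct elements of $A$, and $\gcd(A)$ is the greatest common divisor of all nonzero elements of $A$. For integers $a,b$, $[a,b]=\{x\in\mathbb{Z}: a\leqslant x\leqslant b\}$. $3\mathbb{Z}+1$ denotes the set of integers congruent to $1$ modulo $3$. *)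

theory Defs
  imports "HOL-Number_Theory.Cong"
begin

definition restricted_sumset :: "int set \<Rightarrow> int set" where
  "restricted_sumset A = {a + b | a b. a \<in> A \<and> b \<in> A \<and> a \<noteq> b}"

end

theory Submission
  imports Defs
begin

text \<open>
  Write \<open>l = a (k - 1)\<close> for the largest element of \<open>A\<close>, \<open>B = A - {l}\<close>, \<open>n = k - 1\<close> for the size of \<open>B\<close>,
  \<open>m\<close> for its maximum, and \<open>S\<close> for the set of sums of two distinct elements of \<open>B\<close>. The hypothesis
  \<open>a i < 2 i\<close> says that \<open>B\<close> fills more than half of every interval \<open>[0, x)\<close> with \<open>x < 2 n\<close>. By
  the pigeonhole principle a number \<open>h < 2 n - 1\<close> can then fail to be in \<open>S\<close> only in a critical way:
  \<open>h = 2 i\<close> with \<open>i \<in> B\<close>, and \<open>x \<mapsto> h - x\<close> exchanges \<open>B\<close> with its complement on \<open>[0, h]\<close>, except at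
  the fixed point \<open>i\<close>. Such \<open>i\<close> are called centres. Two centres \<open>i < j\<close> satisfy \<open>j > 2 i\<close>, since
  otherwise the two reflections would compose to a translation whose first period is only half full.

  The sumset of \<open>A\<close> is the disjoint union of \<open>l + B\<close>, of \<open>S\<close> below \<open>2 n - 1\<close>, and of the remaining
  elements \<open>m + y\<close> of \<open>S\<close>, which are parametrised by a set \<open>extra\<close>. So its size is
  \<open>3 n - 2 - card centres + card extra\<close>, and the inequality says that the number of centres exceeds
  the number of extra elements by at most two, with equality in the two listed families only.

  Extra elements come from \<open>m + b\<close> with \<open>b \<in> B\<close>: such a sum is extra unless \<open>b - D \<in> B\<close>, where
  \<open>D = l - m\<close>. Hence if there are few extra elements, \<open>B\<close> is almost closed under subtraction of \<open>D\<close>,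
  and the number of its elements in a window of length \<open>D\<close> can only decrease as the window moves up.
  At a centre \<open>i \<ge> D\<close> the last window before \<open>2 i\<close> is the reflected complement of the first one, hence
  less than half full; by monotonicity so is the next one, which contradicts the density of \<open>B\<close>.
  So each centre \<open>i \<ge> D\<close> other than the last forces an extra element just above \<open>2 i\<close>
  (\<open>large_violation\<close>). With \<open>E = 2 n - 1 - m\<close>, a centre in \<open>[E, D)\<close> is itself extra. For centres
  below \<open>E\<close>, extra elements are found by counting the gaps of \<open>B\<close> (\<open>sum_of_gaps\<close>, \<open>two_tiny\<close>).
  The delicate case is that of exactly one centre below \<open>E\<close> (\<open>one_tiny\<close>): there the count can only
  fail if \<open>E = 2\<close>, \<open>D = 3\<close>. If moreover the number of centres exceeds the number of extra elements by two,
  there are no extra elements at all; then \<open>B\<close> is closed under subtraction of \<open>3\<close> and antisymmetric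
  about \<open>n - 1/2\<close>, which leaves exactly the two families (\<open>extremal_structure\<close>).
\<close>

section \<open>Numbers that are not sums of two distinct elements\<close>

lemma restricted_sumsetI: "x \<in> A \<Longrightarrow> y \<in> A \<Longrightarrow> x \<noteq> y \<Longrightarrow> x + y \<in> restricted_sumset A"
  unfolding restricted_sumset_def by blast

lemma restricted_sumsetE:
  assumes "s \<in> restricted_sumset A"
  obtains x y where "x \<in> A" "y \<in> A" "x < y" "s = x + y"
proof -
  obtain a b where ab: "a \<in> A" "b \<in> A" "a \<noteq> b" "s = a + b"
    using assms unfolding restricted_sumset_def by blast
  show thesis
  proof (cases "a < b")
    case True
    then show thesis using ab that by blast
  next
    case False
    then have "b < a" "s = b + a" using ab by auto
    then show thesis using ab that by blast
  qed
qed

lemma unrepresented_reflect: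
  assumes "s \<notin> restricted_sumset A" "x \<in> A" "s \<noteq> 2 * x"
  shows "s - x \<notin> A"
  using assms restricted_sumsetI[of x A "s - x"] by auto

text \<open>
  If \<open>p + q\<close> is not a sum, the reflection \<open>x \<mapsto> p + q - x\<close> of the interval \<open>[p, q]\<close> moves the elements of \<open>A\<close>,
  apart from a possible fixed point, out of \<open>A\<close>. In the tight case nothing else is left outside \<open>A\<close>, so
  the reflection exchanges \<open>A\<close> and its complement.
\<close>
lemma unrepresented_card:
  fixes A :: "int set"
  assumes "p + q \<notin> restricted_sumset A"
  shows "card (A \<inter> {p..q}) + card (A \<inter> {p..q} - {c. 2 * c = p + q}) \<le> card {p..q}"
    and "card (A \<inter> {p..q}) + card (A \<inter> {p..q} - {c. 2 * c = p + q}) = card {p..q}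
      \<Longrightarrow> x \<in> {p..q} \<Longrightarrow> x \<notin> A \<Longrightarrow> p + q - x \<in> A"
proof -
  define X where "X = A \<inter> {p..q}"
  define X' where "X' = (\<lambda>x. p + q - x) ` (X - {c. 2 * c = p + q})"
  have fin: "finite X" "finite X'" unfolding X'_def X_def by auto
  have disj: "X \<inter> X' = {}"
    using unrepresented_reflect[OF assms] unfolding X'_def X_def by fastforce
  have card': "card X' = card (X - {c. 2 * c = p + q})"
    unfolding X'_def by (rule card_image) (auto simp: inj_on_def)
  have sub: "X \<union> X' \<subseteq> {p..q}" unfolding X'_def X_def by auto
  have un: "card (X \<union> X') = card X + card (X - {c. 2 * c = p + q})"
    using card_Un_disjoint[OF fin disj] card' by simp
  show "card (A \<inter> {p..q}) + card (A \<inter> {p..q} - {c. 2 * c = p + q}) \<le> card {p..q}"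
    using card_mono[OF _ sub] un unfolding X_def by simp
  assume eq: "card (A \<inter> {p..q}) + card (A \<inter> {p..q} - {c. 2 * c = p + q}) = card {p..q}"
    and x: "x \<in> {p..q}" "x \<notin> A"
  have "X \<union> X' = {p..q}"
    using card_subset_eq[OF _ sub] un eq unfolding X_def by simp
  then have "x \<in> X'" using x unfolding X_def by blast
  then show "p + q - x \<in> A" unfolding X'_def X_def by auto
qed

lemma unrepresented_card_bound:
  fixes A :: "int set"
  assumes "p + q \<notin> restricted_sumset A" "p \<le> q + 1"
  shows "2 * int (card (A \<inter> {p..q})) \<le> q - p + 2"
proof -
  let ?X = "A \<inter> {p..q}" and ?c = "(p + q) div 2"
  have "?X - {?c} \<subseteq> ?X - {c. 2 * c = p + q}" by auto
  then have "card (?X - {?c}) \<le> card (?X - {c. 2 * c = p + q})" by (intro card_mono) auto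
  moreover have "card ?X \<le> card (?X - {?c}) + 1"
    using card_Diff1_le[of ?X ?c] by (cases "?c \<in> ?X") (auto simp: card_Suc_Diff1)
  moreover have "card {p..q} = nat (q - p + 1)" by simp
  ultimately show ?thesis using unrepresented_card(1)[OF assms(1)] assms(2) by linarith
qed

section \<open>Half-dense sets and their centres\<close>

text \<open>
  The set \<open>B\<close> is \<open>A\<close> without its largest element \<open>l = m + D\<close>. The parameters \<open>D\<close> and \<open>E\<close> measure how far \<open>m\<close> lies
  below \<open>l\<close> and below \<open>2 n - 1\<close>; thus \<open>m + y\<close> reaches \<open>2 n - 1\<close> at \<open>y = E\<close> and \<open>l\<close> at \<open>y = D\<close>. The condition \<open>E + 1 \<le> D\<close>
  is \<open>l \<ge> 2 n\<close>.
\<close>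
locale half_dense =
  fixes B :: "int set" and n m D E :: int
  assumes B_sub: "B \<subseteq> {0..m}" and m_in: "m \<in> B" and zero_in: "0 \<in> B" and one_in: "1 \<in> B"
    and card_B: "int (card B) = n"
    and mE: "m + E = 2 * n - 1" and E_ge: "2 \<le> E" and D_gt: "E + 1 \<le> D"
    and dense: "1 \<le> x \<Longrightarrow> x \<le> 2 * n - 1 \<Longrightarrow> x + 1 \<le> 2 * int (card (B \<inter> {0..<x}))"
begin

abbreviation S :: "int set" where "S \<equiv> restricted_sumset B"

definition cnt :: "int \<Rightarrow> int" where "cnt x = int (card (B \<inter> {0..<x}))"
definition gaps :: "int \<Rightarrow> int" where "gaps x = int (card ({0..<x} - B))"

definition centres :: "int set" where "centres = {i \<in> B. 1 \<le> i \<and> i \<le> n - 1 \<and> 2 * i \<notin> S}"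

text \<open>
  The sums of two elements of \<open>B\<close> that are at least \<open>2 n - 1\<close> and not in \<open>l + B\<close>, shifted down by \<open>m\<close>
  because most of them will be found in the form \<open>m + y\<close> with \<open>y\<close> small.
\<close>
definition extra :: "int set" where "extra = {y. E \<le> y \<and> m + y \<in> S \<and> y - D \<notin> B}"

lemma finite_B: "finite B" using B_sub finite_subset by blast

lemma cnt_gaps: "0 \<le> x \<Longrightarrow> cnt x + gaps x = x"
proof -
  assume "0 \<le> x"
  have "card {0..<x} = card ({0..<x} \<inter> B) + card ({0..<x} - B)"
    by (rule card_Int_Diff) simp
  then show ?thesis using \<open>0 \<le> x\<close> unfolding cnt_def gaps_def by (simp add: Int_commute)
qed

lemma gaps_Suc: "0 \<le> x \<Longrightarrow> gaps (x + 1) = gaps x + (if x \<in> B then 0 else 1)"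
proof -
  assume "0 \<le> x"
  then have "{0..<x + 1} = insert x {0..<x}" by auto
  then show ?thesis unfolding gaps_def by (auto simp: insert_Diff_if)
qed

lemma gaps_0: "gaps 0 = 0" unfolding gaps_def by simp

lemma gaps_mono: "x \<le> y \<Longrightarrow> gaps x \<le> gaps y"
  unfolding gaps_def by (auto intro!: card_mono)

lemma gaps_nonneg: "0 \<le> gaps x" unfolding gaps_def by simp

lemma gaps_ge1: "z \<notin> B \<Longrightarrow> 0 \<le> z \<Longrightarrow> z < x \<Longrightarrow> 1 \<le> gaps x"
  using gaps_Suc[of z] gaps_mono[of "z + 1" x] gaps_nonneg[of z] by simp

lemma gaps_ge2: "z \<notin> B \<Longrightarrow> z' \<notin> B \<Longrightarrow> 0 \<le> z \<Longrightarrow> z < z' \<Longrightarrow> z' < x \<Longrightarrow> 2 \<le> gaps x"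
  using gaps_ge1[of z z'] gaps_Suc[of z'] gaps_mono[of "z' + 1" x] by simp

lemma gaps_upper: "1 \<le> x \<Longrightarrow> x \<le> 2 * n - 1 \<Longrightarrow> 2 * gaps x \<le> x - 1"
  using dense[of x] cnt_gaps[of x] unfolding cnt_def by simp

lemma n_ge: "2 \<le> n"
proof -
  have "card {0, 1::int} \<le> card B" using zero_in one_in finite_B by (intro card_mono) auto
  then show ?thesis using card_B by simp
qed

lemma card_tail: "0 \<le> y \<Longrightarrow> y \<le> m \<Longrightarrow> int (card (B \<inter> {y..m})) = n - cnt y"
proof -
  assume "0 \<le> y" "y \<le> m"
  then have "B = (B \<inter> {0..<y}) \<union> (B \<inter> {y..m})" using B_sub by auto
  then have "card B = card (B \<inter> {0..<y}) + card (B \<inter> {y..m})"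
    using card_Un_disjoint[of "B \<inter> {0..<y}" "B \<inter> {y..m}"] by fastforce
  then show ?thesis using card_B unfolding cnt_def by simp
qed

lemma gaps_top: "m < x \<Longrightarrow> gaps x = x - n"
proof -
  assume "m < x"
  then have "B \<inter> {0..<x} = B" using B_sub by auto
  moreover have "0 \<le> x" using \<open>m < x\<close> m_in B_sub by auto
  ultimately show ?thesis using cnt_gaps[of x] card_B unfolding cnt_def by simp
qed

text \<open>
  The gaps below \<open>y\<close> force elements above \<open>y\<close>, since the size of \<open>B\<close> is given; with enough of them the pigeonhole
  principle applies to the reflection of \<open>[y, m]\<close>.
\<close>
lemma sum_of_gaps:
  assumes "0 \<le> y" "y \<le> m" "y - E + 2 \<le> 2 * gaps y"
  shows "m + y \<in> S"
proof (rule ccontr)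
  assume "m + y \<notin> S"
  then have "2 * int (card (B \<inter> {y..m})) \<le> m - y + 2"
    using unrepresented_card_bound[of y m B] assms by (simp add: add.commute)
  then show False using card_tail[of y] assms cnt_gaps[of y] mE by simp
qed

lemma sum_of_member: "y \<in> B \<Longrightarrow> y \<noteq> m \<Longrightarrow> m + y \<in> S"
  using restricted_sumsetI m_in by blast

text \<open>
  The density of \<open>B\<close> just meets the pigeonhole bound on \<open>[0, h]\<close>. This rules out odd \<open>h\<close> and makes the
  reflection tight.
\<close>
lemma missing:
  assumes h: "1 \<le> h" "h \<le> 2 * n - 2" "h \<notin> S"
  shows "\<exists>i \<in> centres. h = 2 * i \<and> (\<forall>x. 0 \<le> x \<and> x \<le> h \<and> x \<noteq> i \<longrightarrow> (x \<in> B \<longleftrightarrow> h - x \<notin> B))"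
proof -
  let ?X = "B \<inter> {0..h}" and ?c = "h div 2"
  have hS: "0 + h \<notin> S" using h by simp
  have dn: "h + 2 \<le> 2 * int (card ?X)"
  proof -
    have "{0..h} = {0..<h + 1}" by auto
    then show ?thesis using dense[of "h + 1"] h by simp
  qed
  have ub: "2 * int (card ?X) \<le> h + 2" using unrepresented_card_bound[OF hS] h by simp
  have eqc: "2 * int (card ?X) = h + 2" using dn ub by simp
  have ev: "h = 2 * ?c" using eqc by presburger
  have cB: "?c \<in> B"
  proof (rule ccontr)
    assume "?c \<notin> B"
    then have "?X - {c. 2 * c = 0 + h} = ?X" using ev by auto
    then show False using unrepresented_card(1)[OF hS] eqc h by simp
  qed
  have Xc: "?X - {c. 2 * c = 0 + h} = ?X - {?c}" using ev by auto
  have "?c \<in> ?X" using cB h by auto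
  then have "card (?X - {?c}) + 1 = card ?X"
    using card_Suc_Diff1[of ?X ?c] by simp
  then have tight: "card ?X + card (?X - {c. 2 * c = 0 + h}) = card {0..h}"
    unfolding Xc using eqc h by simp
  have refl: "x \<in> B \<longleftrightarrow> h - x \<notin> B" if "0 \<le> x" "x \<le> h" "x \<noteq> ?c" for x
    using unrepresented_card(2)[OF hS tight, of x] unrepresented_reflect[OF h(3), of x] that ev by auto
  show ?thesis
  proof (rule bexI[of _ ?c])
    show "?c \<in> centres" unfolding centres_def using cB h ev by auto
    show "h = 2 * ?c \<and> (\<forall>x. 0 \<le> x \<and> x \<le> h \<and> x \<noteq> ?c \<longrightarrow> (x \<in> B \<longleftrightarrow> h - x \<notin> B))"
      using ev refl by blast
  qed
qed

lemma centre_reflect: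
  assumes "i \<in> centres" "0 \<le> x" "x \<le> 2 * i" "x \<noteq> i"
  shows "x \<in> B \<longleftrightarrow> 2 * i - x \<notin> B"
proof -
  have i: "1 \<le> 2 * i" "2 * i \<le> 2 * n - 2" "2 * i \<notin> S" using assms(1) unfolding centres_def by auto
  obtain j where "2 * i = 2 * j"
    and j: "\<forall>x. 0 \<le> x \<and> x \<le> 2 * i \<and> x \<noteq> j \<longrightarrow> (x \<in> B \<longleftrightarrow> 2 * i - x \<notin> B)"
    using missing[OF i] by blast
  then have "j = i" by simp
  then show ?thesis using j assms by blast
qed

lemma centreD:
  assumes "i \<in> centres"
  shows "i \<in> B" "1 \<le> i" "i \<le> n - 1" "2 * i \<notin> S" "2 * i \<notin> B"
proof -
  show i: "i \<in> B" "1 \<le> i" "i \<le> n - 1" "2 * i \<notin> S" using assms unfolding centres_def by auto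
  show "2 * i \<notin> B" using centre_reflect[OF assms, of 0] zero_in i by simp
qed

text \<open>
  Antisymmetry about a centre, in terms of counting: each pair \<open>i - x, i + x\<close> contains exactly one gap.
\<close>
lemma gaps_reflect:
  assumes "i \<in> centres" "0 \<le> b" "b \<le> i"
  shows "gaps (i + 1 + b) = b + gaps (i - b)"
  using assms(2,3)
proof (induction b rule: int_ge_induct)
  case base
  then show ?case using gaps_Suc[of i] centreD[OF assms(1)] by simp
next
  case (step b)
  have "gaps (i - b) = gaps (i - (b + 1)) + (if i - (b + 1) \<in> B then 0 else 1)"
    using gaps_Suc[of "i - (b + 1)"] step by (simp add: algebra_simps)
  moreover have "gaps (i + 1 + (b + 1)) = gaps (i + 1 + b) + (if i + 1 + b \<in> B then 0 else 1)"
    using gaps_Suc[of "i + 1 + b"] step centreD(2)[OF assms(1)] by (simp add: algebra_simps)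
  moreover have "i + 1 + b \<in> B \<longleftrightarrow> i - (b + 1) \<notin> B"
    using centre_reflect[OF assms(1), of "i + 1 + b"] step by (simp add: algebra_simps)
  ultimately show ?case using step by auto
qed

lemma gaps_at_double: "i \<in> centres \<Longrightarrow> gaps (2 * i + 1) = i"
  using gaps_reflect[of i i] gaps_0 centreD(2)[of i] by (simp add: algebra_simps)

lemma gaps_past_centre: "i \<in> centres \<Longrightarrow> 0 \<le> b \<Longrightarrow> b \<le> i \<Longrightarrow> i + 1 + b \<le> y \<Longrightarrow> b \<le> gaps y"
  using gaps_reflect[of i b] gaps_nonneg[of "i - b"] gaps_mono[of "i + 1 + b" y] by simp

lemma succ_double_in:
  assumes "i \<in> centres" "i < n - 1"
  shows "2 * i + 1 \<in> B"
proof -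
  have "0 \<le> i" using centreD(2)[OF assms(1)] by simp
  then have "gaps (2 * i + 2) = i + (if 2 * i + 1 \<in> B then 0 else 1)"
    using gaps_at_double[OF assms(1)] gaps_Suc[of "2 * i + 1"] by (simp add: add.commute)
  moreover have "2 * gaps (2 * i + 2) \<le> 2 * i + 1"
    using gaps_upper[of "2 * i + 2"] assms(2) \<open>0 \<le> i\<close> by simp
  ultimately show ?thesis by (auto split: if_splits)
qed

text \<open>
  If \<open>j \<le> 2 i\<close>, reflecting \<open>(2 i, 2 j]\<close> about \<open>j\<close> gives \<open>[0, 2 (j - i))\<close>, and then exactly half of this initial
  segment would belong to \<open>B\<close>, which is too little.
\<close>
lemma centres_growth:
  assumes "i \<in> centres" "j \<in> centres" "i < j"
  shows "2 * i + 1 \<le> j"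
proof (rule ccontr)
  assume small: "\<not> ?thesis"
  define d where "d = 2 * (j - i)"
  have "gaps (j + 1 + (j - d)) = j - d + gaps (j - (j - d))"
    using small assms(3) by (intro gaps_reflect[OF assms(2)]) (auto simp: d_def)
  moreover have "j + 1 + (j - d) = 2 * i + 1" "j - (j - d) = d" by (simp_all add: d_def)
  ultimately have "gaps (2 * i + 1) = j - d + gaps d" by metis
  moreover have "2 * j = 2 * i + d" by (simp add: d_def)
  ultimately have "2 * gaps d = d" using gaps_at_double[OF assms(1)] by linarith
  moreover have "2 * gaps d \<le> d - 1"
    using assms(3) centreD[OF assms(1)] centreD[OF assms(2)] by (intro gaps_upper) (auto simp: d_def)
  ultimately show False by simp
qed

lemma finite_centres: "finite centres" unfolding centres_def using finite_B by simp

lemma S_bounds: "s \<in> S \<Longrightarrow> 1 \<le> s \<and> s \<le> 2 * m - 1"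
proof -
  assume "s \<in> S"
  then obtain x y where "x \<in> B" "y \<in> B" "x < y" "s = x + y" by (rule restricted_sumsetE)
  moreover from this have "0 \<le> x" "y \<le> m" using B_sub by auto
  ultimately show ?thesis by linarith
qed

lemma finite_extra: "finite extra"
proof -
  have "extra \<subseteq> {E..2 * m}" unfolding extra_def using S_bounds E_ge by fastforce
  then show ?thesis using finite_subset by blast
qed

text \<open>
  The three parts are the translate \<open>l + B\<close>, the sums below \<open>2 n - 1\<close>, where exactly the doubles of centres
  are missing, and the extra sums.
\<close>
lemma card_sumset_insert:
  "int (card (restricted_sumset (insert (m + D) B))) = 3 * n - 2 - int (card centres) + int (card extra)"
proof -
  let ?l = "m + D"
  have lB: "?l \<notin> B" using B_sub D_gt E_ge by auto
  have split: "restricted_sumset (insert ?l B) = S \<union> (+) ?l ` B"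
  proof (intro equalityI subsetI)
    fix s assume "s \<in> restricted_sumset (insert ?l B)"
    then obtain x y where xy: "x \<in> insert ?l B" "y \<in> insert ?l B" "x < y" "s = x + y"
      by (rule restricted_sumsetE)
    show "s \<in> S \<union> (+) ?l ` B"
    proof (cases "x = ?l \<or> y = ?l")
      case True
      then show ?thesis using xy by (auto simp: add.commute)
    next
      case False
      then show ?thesis using xy restricted_sumsetI[of x B y] by auto
    qed
  next
    fix s assume "s \<in> S \<union> (+) ?l ` B"
    then show "s \<in> restricted_sumset (insert ?l B)"
      using lB unfolding restricted_sumset_def by blast
  qed
  let ?low = "S \<inter> {1..2 * n - 2}" and ?high = "(+) m ` extra"
  have parts: "S \<union> (+) ?l ` B = ?low \<union> ?high \<union> (+) ?l ` B"
  proof -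
    have "s \<in> ?low \<union> ?high \<union> (+) ?l ` B" if s: "s \<in> S" for s
    proof (cases "s \<le> 2 * n - 2 \<or> s - ?l \<in> B")
      case True
      then show ?thesis using s S_bounds[OF s] by (auto intro: image_eqI[of _ _ "s - ?l"])
    next
      case False
      then have "s - m \<in> extra" unfolding extra_def using s mE by (auto simp: algebra_simps)
      then show ?thesis by (auto intro: image_eqI[of _ _ "s - m"])
    qed
    moreover have "?high \<subseteq> S" unfolding extra_def by auto
    ultimately show ?thesis by blast
  qed
  have d1: "?low \<inter> ?high = {}" unfolding extra_def using mE by auto
  have d2: "(?low \<union> ?high) \<inter> (+) ?l ` B = {}"
    unfolding extra_def using mE D_gt B_sub by (auto simp: algebra_simps)
  have "card (restricted_sumset (insert ?l B)) = card ?low + card ?high + card ((+) ?l ` B)"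
    unfolding split parts using d1 d2 finite_extra finite_B
    by (subst card_Un_disjoint; simp add: card_Un_disjoint)
  moreover have "card ?high = card extra" "card ((+) ?l ` B) = card B"
    by (auto intro!: card_image simp: inj_on_def)
  moreover have "int (card ?low) = 2 * n - 2 - int (card centres)"
  proof -
    have "{1..2 * n - 2} - S \<subseteq> (*) 2 ` centres"
      using missing by fastforce
    moreover have "(*) 2 ` centres \<subseteq> {1..2 * n - 2} - S" unfolding centres_def by auto
    ultimately have "{1..2 * n - 2} - S = (*) 2 ` centres" by blast
    then have "card ({1..2 * n - 2} - S) = card centres"
      by (simp add: card_image inj_on_def)
    then show ?thesis using card_Int_Diff[of "{1..2 * n - 2}" S] n_ge by (simp add: Int_commute)
  qed
  ultimately show ?thesis using card_B by simp
qed

section \<open>Extra sums produced by centres\<close>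

text \<open>
  Centres are split according to how they produce extra sums: a medium centre is itself extra, a large
  one forces an extra element above its double, and tiny ones have to be treated together.
\<close>
definition tiny :: "int set" where "tiny = {i \<in> centres. i < E}"
definition medium :: "int set" where "medium = {i \<in> centres. E \<le> i \<and> i < D}"
definition large :: "int set" where "large = {i \<in> centres. D \<le> i}"

lemma below_D_notin: "y < D \<Longrightarrow> y - D \<notin> B" using B_sub by auto

lemma nonneg_m: "1 \<le> m" using one_in B_sub by auto

lemma extra_of_member: "y \<in> B \<Longrightarrow> y \<noteq> m \<Longrightarrow> E \<le> y \<Longrightarrow> y - D \<notin> B \<Longrightarrow> y \<in> extra"
  unfolding extra_def using sum_of_member by simp

lemma extra_of_gaps:
  "E \<le> y \<Longrightarrow> y \<le> m \<Longrightarrow> y - E + 2 \<le> 2 * gaps y \<Longrightarrow> y - D \<notin> B \<Longrightarrow> y \<in> extra"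
  unfolding extra_def using sum_of_gaps[of y] E_ge by simp

lemma medium_extra: "medium \<subseteq> extra"
proof
  fix i assume "i \<in> medium"
  then have i: "i \<in> centres" "E \<le> i" "i < D" unfolding medium_def by auto
  show "i \<in> extra"
  proof (rule extra_of_member)
    show "i \<noteq> m" using mE i(2) centreD(3)[OF i(1)] by auto
  qed (use i centreD below_D_notin in auto)
qed

text \<open>
  Monotonicity of windows: where \<open>B\<close> is closed under subtraction of \<open>D\<close>, moving an interval up by \<open>D\<close> can only
  create gaps.
\<close>
lemma gaps_shift:
  assumes "0 \<le> q" "q \<le> r" "\<And>b. b \<in> B \<Longrightarrow> q + D \<le> b \<Longrightarrow> b < r + D \<Longrightarrow> b - D \<in> B"
  shows "gaps r - gaps q \<le> gaps (r + D) - gaps (q + D)"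
  using assms(2,3)
proof (induction r rule: int_ge_induct)
  case base
  then show ?case by simp
next
  case (step r)
  have IH: "gaps r - gaps q \<le> gaps (r + D) - gaps (q + D)"
    by (rule step.IH) (use step.prems in auto)
  have r: "0 \<le> r" "0 \<le> r + D" using step assms(1) D_gt E_ge by auto
  have "r + D \<in> B \<Longrightarrow> r \<in> B" using step.prems[of "r + D"] step.hyps by auto
  moreover have eq: "r + 1 + D = r + D + 1" by simp
  ultimately show ?case unfolding eq using IH gaps_Suc[OF r(1)] gaps_Suc[OF r(2)] by (auto split: if_splits)
qed

text \<open>
  Without the element \<open>b\<close>, the window \<open>(2 i, 2 i + D]\<close> would have at least as many gaps as the window of length
  \<open>D\<close> ending at \<open>2 i\<close>. By reflection that one has as many gaps as \<open>[0, D)\<close> has elements, so more than half, and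
  \<open>B\<close> would not be dense on \<open>[0, 2 i + D]\<close>. The later centre \<open>j\<close> leaves enough room below \<open>m\<close>.
\<close>
lemma large_violation:
  assumes "i \<in> large" "j \<in> centres" "i < j"
  obtains b where "b \<in> B" "b \<in> extra" "2 * i < b" "b \<le> 2 * i + D" "b < m" "b - D \<notin> B"
proof -
  have i: "i \<in> centres" "D \<le> i" using assms(1) unfolding large_def by auto
  have grow: "2 * i + 1 \<le> j" "j \<le> n - 1"
    using centres_growth[OF i(1) assms(2,3)] centreD(3)[OF assms(2)] by auto
  have room: "2 * i + D < m" using grow i(2) mE D_gt by linarith
  have "\<exists>b \<in> B. 2 * i < b \<and> b \<le> 2 * i + D \<and> b - D \<notin> B"
  proof (rule ccontr)
    assume "\<not> ?thesis"
    then have no: "b - D \<in> B" if "b \<in> B" "2 * i < b" "b \<le> 2 * i + D" for b using that by blast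
    let ?q = "2 * i + 1 - D" and ?r = "2 * i + 1"
    have "gaps ?r - gaps ?q \<le> gaps (?r + D) - gaps (?q + D)"
      using i E_ge D_gt by (intro gaps_shift) (auto intro: no)
    moreover have "?q + D = ?r" by simp
    moreover have "gaps ?q = i - D + gaps D"
    proof -
      have "gaps (i + 1 + (i - D)) = i - D + gaps (i - (i - D))"
        using i D_gt E_ge by (intro gaps_reflect) auto
      moreover have "i + 1 + (i - D) = ?q" "i - (i - D) = D" by auto
      ultimately show ?thesis by metis
    qed
    moreover have "gaps ?r = i" by (rule gaps_at_double[OF i(1)])
    moreover have "2 * gaps D \<le> D - 1" using grow i D_gt E_ge by (intro gaps_upper) auto
    moreover have "2 * gaps (?r + D) \<le> ?r + D - 1" using grow i D_gt E_ge by (intro gaps_upper) auto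
    ultimately show False by (smt (verit))
  qed
  then obtain b where b: "b \<in> B" "2 * i < b" "b \<le> 2 * i + D" "b - D \<notin> B" by blast
  moreover have "b \<in> extra" using b room i D_gt by (intro extra_of_member) auto
  ultimately show thesis using that room by auto
qed

text \<open>
  The windows \<open>(2 i, 2 i + D]\<close> for different large centres are disjoint by \<open>centres_growth\<close>.
\<close>
lemma large_count:
  assumes "L \<subseteq> large" "\<And>i. i \<in> L \<Longrightarrow> p \<le> i \<and> i \<le> q" "\<And>i. i \<in> L \<Longrightarrow> \<exists>j \<in> centres. i < j"
  shows "card L \<le> card (extra \<inter> {2 * p<..2 * q + D})"
proof -
  have "\<forall>i \<in> L. \<exists>b. b \<in> extra \<and> 2 * i < b \<and> b \<le> 2 * i + D"
    using large_violation assms(1,3) by (metis subsetD)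
  then obtain f where f: "\<And>i. i \<in> L \<Longrightarrow> f i \<in> extra \<and> 2 * i < f i \<and> f i \<le> 2 * i + D" by metis
  have mono: "f i < f j" if ij: "i \<in> L" "j \<in> L" "i < j" for i j
  proof -
    have "i \<in> centres" "j \<in> centres" "D \<le> i" using ij assms(1) unfolding large_def by auto
    then have "2 * i + 1 \<le> j" "D \<le> i" "0 \<le> i"
      using centres_growth[of i j] ij(3) centreD(2)[of i] by auto
    then show ?thesis using f[OF ij(1)] f[OF ij(2)] by linarith
  qed
  have "inj_on f L" by (rule inj_onI) (metis mono less_irrefl linorder_neqE)
  moreover have "f ` L \<subseteq> extra \<inter> {2 * p<..2 * q + D}"
    using f assms(2) by fastforce
  ultimately show ?thesis using finite_extra by (meson card_inj_on_le finite_Int)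
qed

text \<open>
  All \<open>n - E\<close> gaps of \<open>B\<close> in \<open>[0, m]\<close> include the \<open>i\<close> gaps up to \<open>2 i\<close>. The hypothesis on \<open>gaps i\<close> excludes
  the degenerate situation \<open>m < 2 i\<close>. The conclusion keeps the elements \<open>y\<close> to which \<open>sum_of_gaps\<close> is applied
  below \<open>m\<close>.
\<close>
lemma centre_room:
  assumes "i \<in> centres" "i - E + 2 \<le> gaps i"
  shows "i + E \<le> n"
proof -
  have gm: "gaps (m + 1) = n - E" using gaps_top[of "m + 1"] mE by simp
  show ?thesis
  proof (cases "2 * i \<le> m")
    case True
    then show ?thesis using gaps_mono[of "2 * i + 1" "m + 1"] gaps_at_double[OF assms(1)] gm by simp
  next
    case False
    then have "gaps (2 * i + 1) = 2 * i + 1 - n" by (intro gaps_top) simp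
    moreover have "i \<le> m" using centreD(1)[OF assms(1)] B_sub by auto
    then have "gaps i \<le> gaps (m + 1)" by (intro gaps_mono) simp
    ultimately show ?thesis using gaps_at_double[OF assms(1)] assms(2) gm by simp
  qed
qed

text \<open>
  Let \<open>i\<close> be the largest tiny centre. Around \<open>i\<close> there are so many gaps that \<open>sum_of_gaps\<close> applies to nearly
  all \<open>y\<close> from \<open>E\<close> to \<open>E + 2 i - 2\<close>. Such a \<open>y\<close> is extra if \<open>y < D\<close> or if \<open>y - D\<close> is a gap. When \<open>D\<close> is close to
  \<open>E\<close>, the gaps \<open>2 g\<close> given by the smaller tiny centres \<open>g\<close> provide enough such \<open>y\<close>; otherwise there are enough \<open>y < D\<close>.
  The bound on \<open>z\<close> keeps these elements apart from those of \<open>large_count\<close>.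
\<close>
lemma two_tiny:
  assumes "2 \<le> card tiny"
  obtains Z where "Z \<subseteq> extra" "card tiny + card medium \<le> card Z"
    "\<And>z j. z \<in> Z \<Longrightarrow> j \<in> large \<Longrightarrow> z \<le> 2 * j"
proof -
  have fin: "finite tiny" "finite medium" unfolding tiny_def medium_def using finite_centres by auto
  define i where "i = Max tiny"
  have "tiny \<noteq> {}" using assms by auto
  then have iT: "i \<in> tiny" and imax: "\<And>g. g \<in> tiny \<Longrightarrow> g \<le> i"
    unfolding i_def using fin by auto
  then have i: "i \<in> centres" "i < E" unfolding tiny_def by auto
  have below: "2 * g + 1 \<le> i" "1 \<le> g" "2 * g \<notin> B" if "g \<in> tiny - {i}" for g
  proof -
    have "g \<in> centres" "g < i" using that imax[of g] unfolding tiny_def by auto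
    then show "2 * g + 1 \<le> i" "1 \<le> g" "2 * g \<notin> B" using centres_growth i(1) centreD by auto
  qed
  have card_rest: "card (tiny - {i}) + 1 = card tiny"
    using card_Suc_Diff1[OF fin(1) iT] by simp
  then have "card (tiny - {i}) \<noteq> 0" using assms by linarith
  then have "tiny - {i} \<noteq> {}" by (metis card.empty)
  then obtain g where g: "g \<in> tiny - {i}" by blast
  have i3: "3 \<le> i" using below[OF g] by simp
  have gaps_i: "1 \<le> gaps i" using below[OF g] by (intro gaps_ge1[of "2 * g"]) auto
  have nE: "i + E \<le> n" using centre_room[OF i(1)] gaps_i i(2) by simp
  have card_tiny: "int (card tiny) \<le> i - 1"
  proof -
    have "(*) 2 ` (tiny - {i}) \<subseteq> {2..i - 1}" using below by fastforce
    then have "card ((*) 2 ` (tiny - {i})) \<le> card {2..i - 1}" by (intro card_mono) auto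
    then have "card (tiny - {i}) \<le> nat (i - 2)" by (simp add: card_image inj_on_def)
    then show ?thesis using card_rest i3 by linarith
  qed
  have represented: "E + a \<le> m \<and> a + 2 \<le> 2 * gaps (E + a)"
    if a: "0 \<le> a" "a \<le> 2 * i - 2" "a = 0 \<or> 2 \<le> a \<or> i + 2 \<le> E" for a
  proof
    show "E + a \<le> m" using a nE mE by linarith
    consider "a = 0" | "a = 1" "i + 2 \<le> E" | "2 \<le> a" "a \<le> i" | "i < a" using a by linarith
    then show "a + 2 \<le> 2 * gaps (E + a)"
    proof cases
      case 1
      then show ?thesis using gaps_i gaps_mono[of i E] i(2) by simp
    next
      case 2
      then show ?thesis using gaps_past_centre[OF i(1), of 2 "E + a"] i3 by simp
    next
      case 3
      then show ?thesis using gaps_past_centre[OF i(1), of a "E + a"] i(2) by simp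
    next
      case 4
      then show ?thesis using gaps_past_centre[OF i(1), of i "E + a"] i(2) i3 a by simp
    qed
  qed
  have rep_extra: "y \<in> extra"
    if "E \<le> y" "y - E \<le> 2 * i - 2" "y = E \<or> 2 \<le> y - E \<or> i + 2 \<le> E" "y - D \<notin> B" for y
    using represented[of "y - E"] that by (intro extra_of_gaps) auto
  have E_extra: "E \<in> extra" using i3 D_gt by (intro rep_extra below_D_notin) auto
  have large_bound: "D \<le> j" "2 * i + 1 \<le> j" "E \<in> medium \<Longrightarrow> 2 * E + 1 \<le> j" if "j \<in> large" for j
  proof -
    have j: "j \<in> centres" "D \<le> j" using that unfolding large_def by auto
    then show "D \<le> j" "2 * i + 1 \<le> j" using centres_growth[OF i(1) j(1)] i(2) D_gt by auto
    show "2 * E + 1 \<le> j" if "E \<in> medium"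
      using centres_growth[of E j] that j D_gt unfolding medium_def by auto
  qed
  have medium_less: "z < D" if "z \<in> medium" for z using that unfolding medium_def by auto
  show thesis
  proof (cases "D \<le> E + i - 1")
    case True
    \<comment> \<open>If E is a medium centre it is counted already, and D + 2 i replaces it.\<close>
    define X where "X = (if E \<in> medium then tiny else tiny - {i})"
    let ?Z = "insert E medium \<union> (\<lambda>g. D + 2 * g) ` X"
    have last: "D + 2 * i \<in> extra" if Em: "E \<in> medium"
    proof -
      have Ec: "E \<in> centres" using Em unfolding medium_def by simp
      have iE: "2 * i + 1 \<le> E" using centres_growth[OF i(1) Ec i(2)] .
      have "2 \<le> gaps E"
        using below[OF g] iE centreD(5)[OF i(1)] by (intro gaps_ge2[of "2 * g" "2 * i"]) auto
      then have room: "E + E \<le> n" using centre_room[OF Ec] by simp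
      let ?a = "D + 2 * i - E"
      have a: "7 \<le> ?a" "?a \<le> 3 * i - 1" using i3 True D_gt by auto
      have "?a + 2 \<le> 2 * gaps (D + 2 * i)"
      proof (cases "?a - 1 \<le> E")
        case small: True
        have "?a - 1 \<le> gaps (D + 2 * i)"
          using small a by (intro gaps_past_centre[OF Ec]) auto
        then show ?thesis using a by simp
      next
        case False
        have "E \<le> gaps (D + 2 * i)"
          using False a E_ge by (intro gaps_past_centre[OF Ec]) auto
        then show ?thesis using a iE by simp
      qed
      then show ?thesis
        using a room iE mE centreD(5)[OF i(1)] i3 by (intro extra_of_gaps) auto
    qed
    have "D + 2 * g' \<in> extra" if "g' \<in> X" for g'
    proof (cases "g' = i")
      case True
      then show ?thesis using that last unfolding X_def by (auto split: if_splits)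
    next
      case ne: False
      then have "g' \<in> tiny - {i}" using that unfolding X_def by (auto split: if_splits)
      then show ?thesis using below[of g'] True D_gt by (intro rep_extra) auto
    qed
    then have "?Z \<subseteq> extra" using medium_extra E_extra by auto
    moreover have "card tiny + card medium \<le> card ?Z"
    proof -
      have finX: "finite X" unfolding X_def using fin by auto
      have posX: "0 \<le> g'" if "g' \<in> X" for g'
        using that centreD(2) unfolding X_def tiny_def by (fastforce split: if_splits)
      have "insert E medium \<inter> (\<lambda>g. D + 2 * g) ` X = {}"
        using posX medium_less D_gt by fastforce
      then have "card ?Z = card (insert E medium) + card ((\<lambda>g. D + 2 * g) ` X)"
        using fin finX by (intro card_Un_disjoint) auto
      moreover have "card ((\<lambda>g. D + 2 * g) ` X) = card X"
        by (intro card_image) (simp add: inj_on_def)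
      moreover have "card (insert E medium) + card X = card tiny + card medium"
        using card_rest fin unfolding X_def by (auto simp: insert_absorb)
      ultimately show ?thesis by linarith
    qed
    moreover have "z \<le> 2 * j" if z: "z \<in> ?Z" and j: "j \<in> large" for z j
    proof -
      note lb = large_bound[OF j]
      consider "z < D" | g' where "g' \<in> tiny - {i}" "z = D + 2 * g'" | "E \<in> medium" "z = D + 2 * i"
        using z medium_less D_gt unfolding X_def by (fastforce split: if_splits)
      then show ?thesis
      proof cases
        case 1
        then show ?thesis using lb E_ge D_gt by linarith
      next
        case 2
        then show ?thesis using lb below[of g'] i(2) D_gt by linarith
      next
        case 3
        then show ?thesis using lb True i(2) by linarith
      qed
    qed
    ultimately show thesis by (rule that)
  next
    case False
    \<comment> \<open>For E = i + 1 the element E + 1 need not be extra, but then no medium centre lies in this range.\<close>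
    define K where "K = (if i + 2 \<le> E then {E..<E + i} else insert E {E + 2..<E + i})"
    have K_sub: "E \<le> y" "y < E + i" if "y \<in> K" for y
      using that i3 unfolding K_def by (auto split: if_splits)
    have "y \<in> extra" if "y \<in> K" for y
      using that K_sub[OF that] False i3 unfolding K_def
      by (intro rep_extra below_D_notin) (auto split: if_splits)
    then have "K \<union> medium \<subseteq> extra" using medium_extra by auto
    moreover have "card tiny + card medium \<le> card (K \<union> medium)"
    proof -
      have med_ge: "2 * i + 1 \<le> c" "c \<in> centres" "E \<le> c" if "c \<in> medium" for c
        using that centres_growth[OF i(1), of c] i(2) unfolding medium_def by auto
      have finK: "finite K" unfolding K_def by auto
      have un: "card (K \<union> medium) + card (K \<inter> medium) = card K + card medium"
        using card_Un_Int[OF finK fin(2)] by simp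
      show ?thesis
      proof (cases "i + 2 \<le> E")
        case True
        have "card (K \<inter> medium) \<le> 1"
        proof (rule ccontr)
          assume "\<not> ?thesis"
          then obtain c d where "c \<in> K \<inter> medium" "d \<in> K \<inter> medium" "c < d"
            by (metis One_nat_def card_le_Suc0_iff_eq finK finite_Int linorder_neqE)
          then show False using centres_growth[of c d] med_ge K_sub[of d] i(2) by fastforce
        qed
        moreover have "int (card K) = i" using True i3 unfolding K_def by simp
        ultimately show ?thesis using un card_tiny by linarith
      next
        case False
        then have "K \<inter> medium = {}" using med_ge K_sub i(2) by fastforce
        moreover have "int (card K) = i - 1" using False i3 unfolding K_def by simp
        ultimately show ?thesis using un card_tiny by simp
      qed
    qed
    moreover have "z \<le> 2 * j" if z: "z \<in> K \<union> medium" and j: "j \<in> large" for z j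
    proof -
      have "z < D" using z K_sub[of z] medium_less[of z] False by auto
      then show ?thesis using large_bound[OF j] E_ge D_gt by linarith
    qed
    ultimately show thesis by (rule that)
  qed
qed

text \<open>
  For \<open>D = 4\<close>, closure under subtraction of \<open>4\<close> together with antisymmetry about \<open>p\<close> yields three elements of \<open>B\<close> in the window
  \<open>[p - 2, p + 1]\<close>. So no lower window can have only two elements.
\<close>
lemma no_window_four:
  assumes "D = 4" "p \<in> centres" "0 \<le> q" "q \<le> p - 2" "2 \<le> gaps (q + 4) - gaps q"
    and closed: "\<And>b. b \<in> B \<Longrightarrow> q + 4 \<le> b \<Longrightarrow> b \<le> p + 2 \<Longrightarrow> b - 4 \<in> B"
  shows False
proof -
  have "gaps (p - 2) - gaps q \<le> gaps (p - 2 + 4) - gaps (q + 4)"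
    using gaps_shift[of q "p - 2"] assms by simp
  moreover have "p - 2 + 4 = p + 2" by simp
  ultimately have two: "2 \<le> gaps (p + 2) - gaps (p - 2)" using assms(5) by (smt (verit))
  have "gaps (p + 2) = 1 + gaps (p - 1)"
    using gaps_reflect[OF assms(2), of 1] centreD(2)[OF assms(2)] by (simp add: add.commute)
  moreover have "gaps (p - 1) = gaps (p - 2) + (if p - 2 \<in> B then 0 else 1)"
    using gaps_Suc[of "p - 2"] assms(3,4) by simp
  moreover have "p - 2 \<in> B"
    using centre_reflect[OF assms(2), of "p + 2"] closed[of "p + 2"] assms(3,4) by auto
  ultimately show False using two by simp
qed

section \<open>A single centre below \<open>E\<close>\<close>

text \<open>
  The odd number \<open>2 n - 1\<close> has no fixed point under reflection, and \<open>[0, 2 n - 1]\<close> contains twice as many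
  numbers as \<open>B\<close>, so the reflection is tight.
\<close>
lemma reflect_top:
  assumes "2 * n - 1 \<notin> S" "0 \<le> x" "x \<le> 2 * n - 1"
  shows "x \<in> B \<longleftrightarrow> 2 * n - 1 - x \<notin> B"
proof -
  let ?N = "2 * n - 1"
  have B_eq: "B \<inter> {0..?N} = B" using B_sub mE E_ge by auto
  have "2 * c \<noteq> ?N" for c by presburger
  then have "B \<inter> {0..?N} - {c. 2 * c = 0 + ?N} = B" using B_eq by auto
  then have "card (B \<inter> {0..?N}) + card (B \<inter> {0..?N} - {c. 2 * c = 0 + ?N}) = card {0..?N}"
    using card_B B_eq by simp
  moreover have NS: "0 + ?N \<notin> S" using assms(1) by simp
  ultimately have "x \<notin> B \<Longrightarrow> 0 + ?N - x \<in> B"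
    using unrepresented_card(2)[OF NS, of x] assms by simp
  moreover have "x \<in> B \<Longrightarrow> ?N - x \<notin> B"
    using unrepresented_reflect[OF assms(1), of x] \<open>\<And>c. 2 * c \<noteq> ?N\<close> by metis
  ultimately show ?thesis by auto
qed

text \<open>
  The reflection about \<open>2 n - 1\<close> sends the gap \<open>x - 1\<close> to an element which adds up with \<open>x\<close> to \<open>2 n\<close>.
\<close>
lemma consecutive_sum:
  assumes "x \<in> B" "x - 1 \<notin> B" "1 \<le> x" "x < n" "2 * n - 1 \<notin> S"
  shows "2 * n \<in> S"
proof -
  have "2 * n - 1 - (x - 1) \<in> B"
    using reflect_top[OF assms(5), of "x - 1"] assms by simp
  then have "2 * n - x \<in> B" by (simp add: algebra_simps)
  then show ?thesis using restricted_sumsetI[of x B "2 * n - x"] assms by simp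
qed

text \<open>
  The hypothesis says that the region up to \<open>2 p\<close> contains no extra elements apart from the medium centres, which
  is one less than needed to balance all centres below \<open>p\<close>. It has two effects: below \<open>D\<close> all elements of \<open>B\<close> beyond \<open>E\<close> are
  medium centres, and from \<open>D\<close> to \<open>2 p\<close> the set is closed under subtraction of \<open>D\<close>. If \<open>[0, E)\<close> has a gap, then \<open>E\<close> is extra,
  so it is a centre, and the gaps around it produce a forbidden extra element. If \<open>[0, E)\<close> has no gap, then
  \<open>B\<close> begins with \<open>[0, i]\<close> followed by the gap \<open>(i, 2 i]\<close>. In this situation, if \<open>D > E + 1\<close>, one of \<open>2 n - 1\<close> and \<open>2 n\<close>
  is an extra sum, which is compatible with the hypothesis only for \<open>i = 1\<close>, \<open>D = 4\<close>; if \<open>D = E + 1\<close>, the initial block is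
  too dense for monotone windows of length \<open>D\<close>, unless \<open>i\<close> is \<open>1\<close> or \<open>2\<close>. The configurations with \<open>D = 4\<close> that
  survive these counts, \<open>B\<close> beginning with \<open>0, 1, 3, 4\<close> or with \<open>0, 1, 2, 5\<close>, are excluded by \<open>no_window_four\<close>.
\<close>
lemma one_tiny:
  assumes tiny: "tiny = {i}" and p: "p \<in> large"
    and H: "\<And>y. y \<in> extra \<Longrightarrow> y \<le> 2 * p \<Longrightarrow> y \<in> medium"
  shows "E = 2 \<and> D = 3"
proof -
  have i: "i \<in> centres" "i < E" using tiny unfolding tiny_def by auto
  have pc: "p \<in> centres" "D \<le> p" using p unfolding large_def by auto
  have i1: "1 \<le> i" using centreD(2)[OF i(1)] .
  have ip: "2 * i + 1 \<le> p" "p \<le> n - 1"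
    using centres_growth[OF i(1) pc(1)] i pc D_gt centreD(3)[OF pc(1)] by auto
  have medium: "y \<in> centres" "y < D" "2 * i + 1 \<le> y" if "y \<in> medium" for y
    using that centres_growth[OF i(1), of y] i(2) unfolding medium_def by auto
  have closed: "b - D \<in> B" if "b \<in> B" "D \<le> b" "b \<le> 2 * p" "b \<noteq> m" for b
    using extra_of_member[of b] H[of b] medium(2)[of b] that D_gt by force
  have below_D: "b \<in> medium" if "b \<in> B" "E \<le> b" "b < D" "b \<noteq> m" for b
    using extra_of_member[of b] H[of b] below_D_notin[of b] that pc E_ge by linarith
  \<comment> \<open>Here B begins with 0, 1, 3, 4, and the window [3, 6] has two elements.\<close>
  have three: False if "3 \<in> centres" "i = 1" "D = 4" "p + 2 < m" "7 \<le> p"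
  proof -
    have "gaps 7 = 3" "gaps 3 = 1"
      using gaps_at_double[OF that(1)] gaps_at_double[OF i(1)] that(2) by auto
    then show False
      using no_window_four[of p 3] that pc closed by auto
  qed
  have four_in: "4 \<in> B" if "3 \<in> centres" "i = 1"
    using centre_reflect[OF that(1), of 4] centreD(5)[OF i(1)] that by simp
  show ?thesis
  proof (cases "1 \<le> gaps E")
    case True
    then have "E \<in> extra"
      using mE ip pc D_gt i by (intro extra_of_gaps below_D_notin) auto
    then have Em: "E \<in> medium" using H pc D_gt E_ge by simp
    then have Ec: "E \<in> centres" "E < D" "2 * i + 1 \<le> E" using medium by auto
    have Ep: "2 * E + 1 \<le> p" using centres_growth[OF Ec(1) pc(1)] Ec pc by simp
    have m_room: "3 * E + 3 \<le> m" using Ep ip mE by linarith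
    have refl: "E + 1 \<in> B \<longleftrightarrow> E - 1 \<notin> B"
      using centre_reflect[OF Ec(1), of "E + 1"] E_ge by (simp add: algebra_simps)
    have only_E: "y \<noteq> E + 1" "y \<noteq> E + 2" "y < D" if "y \<in> medium" for y
      using centres_growth[OF Ec(1), of y] medium[OF that] Ec i1 by auto
    have far: False if "D \<le> y" "y \<le> 2 * E + 3" "y - E + 2 \<le> 2 * gaps y" "y - D \<notin> B" for y
    proof -
      have "y \<in> extra" using that m_room D_gt E_ge by (intro extra_of_gaps) auto
      then show False using H[of y] only_E(3)[of y] that Ep E_ge by simp
    qed
    have past: "b \<le> gaps y" if "0 \<le> b" "b \<le> E" "E + 1 + b \<le> y" for b y
      using gaps_past_centre[OF Ec(1)] that by blast
    have next_notin: "E + 1 \<notin> B" if "E + 1 < D"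
      using below_D[of "E + 1"] only_E(1)[of "E + 1"] that m_room E_ge by auto
    \<comment> \<open>The first four cases have an extra element: E + 2, or D + z for a gap z, which is E - 1 or E + 1, then E + 1, then 2.\<close>
    consider "E + 3 \<le> D" | "D = E + 1" "4 \<le> E" | "D = E + 2" "5 \<le> E" | "D = E + 2" "E = 4"
      | "D = E + 2" "E = 3" | "D = E + 1" "E = 3"
      using D_gt Ec(3) i1 by linarith
    then show ?thesis
    proof cases
      case 1
      have "2 \<le> gaps (E + 2)"
        using centreD(5)[OF i(1)] next_notin 1 Ec(3) i1 by (intro gaps_ge2[of "2 * i" "E + 1"]) auto
      then have "E + 2 \<in> extra"
        using 1 m_room E_ge by (intro extra_of_gaps below_D_notin) auto
      then show ?thesis using H[of "E + 2"] only_E(2)[of "E + 2"] Ep E_ge by auto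
    next
      case 2
      have "E - 1 \<le> gaps (2 * E)" "E \<le> gaps (2 * E + 2)" using E_ge past by auto
      then show ?thesis using far[of "2 * E"] far[of "2 * E + 2"] refl 2 by auto
    next
      case 3
      have "E \<le> gaps (2 * E + 3)" using E_ge past by auto
      then show ?thesis using far[of "2 * E + 3"] next_notin 3 by auto
    next
      case 4
      then have "i = 1" using Ec(3) i1 by simp
      then have "2 \<notin> B" using centreD(5)[OF i(1)] by simp
      moreover have "3 \<le> gaps 8" using past[of 3 8] 4 by simp
      ultimately show ?thesis using far[of 8] 4 by simp
    next
      case 5
      then have "i = 1" using Ec(3) i1 by simp
      then show ?thesis using four_in next_notin Ec(1) 5 by simp
    next
      case 6
      then have "i = 1" using Ec(3) i1 by simp
      then show ?thesis using three Ec(1) 6 Ep ip mE by auto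
    qed
  next
    case False
    have full: "x \<in> B" if "0 \<le> x" "x < E" for x using gaps_ge1[of x E] that False by auto
    have iE: "E = i + 1"
    proof (rule ccontr)
      assume "E \<noteq> i + 1"
      then have "i + 1 \<in> B" "i - 1 \<in> B" using i(2) i1 full by auto
      then show False using centre_reflect[OF i(1), of "i + 1"] i1 by simp
    qed
    \<comment> \<open>Otherwise reflection about p would move m to E - 1, which is in B.\<close>
    have m_high: "2 * p \<le> m"
    proof (rule ccontr)
      assume low: "\<not> 2 * p \<le> m"
      have "gaps (2 * p + 1) = 2 * p + 1 - n" using low by (intro gaps_top) simp
      then have pn: "p = n - 1" using gaps_at_double[OF pc(1)] by simp
      then have "2 * p - m = E - 1" using mE by simp
      then have "m \<noteq> p \<longrightarrow> m \<notin> B"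
        using centre_reflect[OF pc(1), of m] full[of "E - 1"] low nonneg_m E_ge by auto
      then have "m = p" using m_in by blast
      then have "2 * i < E" using pn mE ip by simp
      then show False using full[of "2 * i"] centreD(5)[OF i(1)] i1 by simp
    qed
    have succ: "2 * i + 1 \<in> B" using succ_double_in[OF i(1)] ip i1 by simp
    show ?thesis
    proof (cases "E + 2 \<le> D")
      case True
      \<comment> \<open>Both E and E + 1 lie below D here, and they stand for the sums 2 n - 1 and 2 n.\<close>
      have "m + (E + 1) = 2 * n" using mE by simp
      moreover have "2 * n - 1 \<in> S \<or> 2 * n \<in> S"
        using consecutive_sum[of "2 * i + 1"] succ centreD(5)[OF i(1)] ip i1 by auto
      ultimately have "m + E \<in> S \<or> m + (E + 1) \<in> S" using mE by metis
      then have "E \<in> extra \<or> E + 1 \<in> extra"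
        using True below_D_notin[of E] below_D_notin[of "E + 1"] E_ge unfolding extra_def by auto
      then have "E \<in> medium \<or> E + 1 \<in> medium"
        using H[of E] H[of "E + 1"] True pc E_ge by auto
      then have "i = 1" "3 \<in> medium" using medium(3)[of E] medium(3)[of "E + 1"] iE i1 by auto
      then have three_c: "3 \<in> centres" "3 < D" using medium by auto
      then have "7 \<le> p" using centres_growth[OF _ pc(1), of 3] pc by simp
      have "4 \<notin> medium" using medium(1)[of 4] centres_growth[of 3 4] three_c by auto
      then have "\<not> 4 < D"
        using below_D[of 4] four_in three_c \<open>i = 1\<close> iE m_high \<open>7 \<le> p\<close> by auto
      then have "D = 4" using three_c by simp
      then show ?thesis using three three_c \<open>i = 1\<close> \<open>7 \<le> p\<close> m_high by auto
    next
      case False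
      then have D: "D = i + 2" using iE D_gt by simp
      consider "i = 1" | "i = 2" | "3 \<le> i" using i1 by linarith
      then show ?thesis
      proof cases
        case 1
        then show ?thesis using D iE by simp
      next
        case 2
        have "gaps 5 = 2" using gaps_at_double[OF i(1)] 2 by simp
        moreover have "gaps 1 = 0" using gaps_Suc[of 0] gaps_0 zero_in by simp
        ultimately show ?thesis
          using no_window_four[of p 1] closed D 2 pc ip m_high by auto
      next
        case 3
        \<comment> \<open>The window [i - 1, 2 i] contains only i - 1 and i.\<close>
        have "gaps (2 * i + 1) - gaps (i - 1) \<le> gaps (2 * i + 1 + D) - gaps (i - 1 + D)"
          using 3 D ip m_high by (intro gaps_shift closed) auto
        moreover have "i - 1 + D = 2 * i + 1" using D by simp
        moreover have "gaps (i - 1) \<le> 0" using gaps_mono[of "i - 1" E] iE \<open>\<not> 1 \<le> gaps E\<close> by simp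
        moreover have "2 * gaps (2 * i + 1 + D) \<le> 2 * i + 1 + D - 1"
          using D ip 3 by (intro gaps_upper) auto
        ultimately show ?thesis using gaps_at_double[OF i(1)] 3 D by (smt (verit))
      qed
    qed
  qed
qed

section \<open>Centres against extra sums\<close>

text \<open>
  Since \<open>2\<close> is not extra, \<open>2 n - 1\<close> is not a sum and \<open>B\<close> is antisymmetric about \<open>n - 1/2\<close>. The violation \<open>b\<close>
  that the last but one centre produces is then reflected to a further violation \<open>2 n + 2 - b\<close>, which makes up for
  the last centre.
\<close>
lemma large_surplus:
  assumes "E = 2" "D = 3" "2 \<notin> B" "2 \<notin> extra" "2 \<le> card large"
  shows "card large \<le> card extra"
proof -
  have m: "m = 2 * n - 3" using mE assms(1) by simp
  have fin: "finite large" unfolding large_def using finite_centres by simp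
  have top: "2 * n - 1 \<notin> S"
    using assms(2,4) below_D_notin[of 2] m unfolding extra_def by (simp add: assms(1))
  define q where "q = Max large"
  have "large \<noteq> {}" using assms(5) by auto
  then have q: "q \<in> large" "\<And>g. g \<in> large \<Longrightarrow> g \<le> q" unfolding q_def using fin by auto
  define L where "L = large - {q}"
  have card_L: "card L + 1 = card large" unfolding L_def using card_Suc_Diff1[OF fin q(1)] by simp
  then have "card L \<noteq> 0" using assms(5) by linarith
  then have "L \<noteq> {}" by (metis card.empty)
  moreover have finL: "finite L" unfolding L_def using fin by simp
  moreover define r where "r = Max L"
  ultimately have r: "r \<in> L" "\<And>g. g \<in> L \<Longrightarrow> g \<le> r" by auto
  then have rq: "r \<in> large" "r < q" using q(2)[of r] unfolding L_def by auto
  have qc: "q \<in> centres" and rc: "r \<in> centres" "3 \<le> r" using q rq assms(2) unfolding large_def by auto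
  have grow: "2 * r + 1 \<le> q" using centres_growth[OF rc(1) qc rq(2)] .
  \<comment> \<open>Since m = 2 n - 3, the number 2 n - 2 is the sum 1 + m, so n - 1 is not a centre.\<close>
  have "m \<noteq> 1" using grow rc centreD(3)[OF qc] m by simp
  then have "2 * (n - 1) \<in> S" using restricted_sumsetI[OF one_in m_in] m by (simp add: algebra_simps)
  then have "q \<noteq> n - 1" using centreD(4)[OF qc] by auto
  then have qn: "q \<le> n - 2" using centreD(3)[OF qc] by simp
  obtain b where b: "b \<in> B" "b \<in> extra" "2 * r < b" "b \<le> 2 * r + D" "b < m" "b - D \<notin> B"
    using large_violation[OF rq(1) qc rq(2)] .
  let ?b' = "2 * n + 2 - b"
  have "?b' \<in> B" using reflect_top[OF top, of "b - 3"] b rc assms(2) m by (simp add: algebra_simps)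
  moreover have "?b' - D \<notin> B"
    using reflect_top[OF top, of b] b rc assms(2) m by (simp add: algebra_simps)
  ultimately have "?b' \<in> extra"
    using b rc m assms(1) by (intro extra_of_member) auto
  moreover have "2 * r + D < ?b'" using b grow qn assms(2) by simp
  ultimately have "extra \<inter> {2 * 0<..2 * r + D} \<subseteq> extra - {?b'}" "?b' \<in> extra" by auto
  then have "card (extra \<inter> {2 * 0<..2 * r + D}) < card extra"
    using finite_extra by (metis card_Diff1_less card_mono finite_Diff le_less_trans)
  moreover have "card L \<le> card (extra \<inter> {2 * 0<..2 * r + D})"
  proof (rule large_count)
    show "L \<subseteq> large" unfolding L_def by auto
    show "0 \<le> i \<and> i \<le> r" if "i \<in> L" for i
      using r(2)[OF that] that centreD(2)[of i] unfolding L_def large_def by auto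
    show "\<exists>j \<in> centres. i < j" if "i \<in> L" for i
      using qc r(2)[OF that] rq by (intro bexI[of _ q]) auto
  qed
  ultimately show ?thesis using card_L by simp
qed

text \<open>
  The large centres except the last are balanced by extra elements above \<open>2 p\<close>, where \<open>p\<close> is the least large centre.
  It remains to balance the tiny and medium centres by extra elements up to \<open>2 p\<close>; if this fails,
  \<open>one_tiny\<close> leaves \<open>E = 2\<close> and \<open>D = 3\<close>.
\<close>
theorem centres_extra:
  "card centres \<le> card extra + 1 \<or>
    (card centres = 2 \<and> extra = {} \<and> E = 2 \<and> D = 3 \<and> 2 \<notin> B \<and> 5 \<le> n)"
proof -
  have fin: "finite tiny" "finite medium" "finite large"
    unfolding tiny_def medium_def large_def using finite_centres by auto
  have "centres = tiny \<union> medium \<union> large" unfolding tiny_def medium_def large_def using D_gt by auto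
  moreover have "tiny \<inter> medium = {}" "(tiny \<union> medium) \<inter> large = {}"
    unfolding tiny_def medium_def large_def using D_gt by auto
  ultimately have split: "card centres = card tiny + card medium + card large"
    using fin by (simp add: card_Un_disjoint)
  have combine: "card centres \<le> card extra + 1"
    if Z: "Z \<subseteq> extra" "card tiny + card medium \<le> card Z" "\<And>z j. z \<in> Z \<Longrightarrow> j \<in> large \<Longrightarrow> z \<le> 2 * j" for Z
  proof (cases "large = {}")
    case True
    then show ?thesis using split Z(2) card_mono[OF finite_extra Z(1)] by simp
  next
    case False
    define p where "p = Min large"
    define q where "q = Max large"
    have pq: "p \<in> large" "q \<in> large" "\<And>g. g \<in> large \<Longrightarrow> p \<le> g \<and> g \<le> q"
      unfolding p_def q_def using False fin(3) by auto
    let ?W = "extra \<inter> {2 * p<..2 * q + D}"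
    have "card (large - {q}) \<le> card ?W"
    proof (rule large_count)
      show "\<exists>j \<in> centres. i < j" if "i \<in> large - {q}" for i
        using that pq(2) pq(3)[of i] unfolding large_def by (intro bexI[of _ q]) auto
    qed (use pq in auto)
    moreover have "card (large - {q}) + 1 = card large" using card_Suc_Diff1[OF fin(3) pq(2)] by simp
    moreover have "card Z + card ?W \<le> card extra"
    proof -
      have "finite Z" "finite ?W" using finite_subset[OF Z(1) finite_extra] finite_extra by auto
      moreover have "Z \<inter> ?W = {}" using Z(3)[OF _ pq(1)] by fastforce
      ultimately have "card Z + card ?W = card (Z \<union> ?W)" by (simp add: card_Un_disjoint)
      also have "\<dots> \<le> card extra" using Z(1) finite_extra by (intro card_mono) auto
      finally show ?thesis .
    qed
    ultimately show ?thesis using split Z(2) by linarith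
  qed
  have medium_low: "z \<le> 2 * j" if "z \<in> medium" "j \<in> large" for z j
    using that D_gt E_ge unfolding medium_def large_def by auto
  consider "card tiny = 0" | "card tiny = 1" | "2 \<le> card tiny" by linarith
  then show ?thesis
  proof cases
    case 1
    then show ?thesis using combine[OF medium_extra] medium_low by simp
  next
    case 3
    then show ?thesis using two_tiny combine by metis
  next
    case 2
    then obtain i where tiny: "tiny = {i}" by (meson card_1_singletonE)
    show ?thesis
    proof (cases "large = {}")
      case True
      then show ?thesis using split 2 card_mono[OF finite_extra medium_extra] by simp
    next
      case False
      define p where "p = Min large"
      have p: "p \<in> large" "\<And>g. g \<in> large \<Longrightarrow> p \<le> g" unfolding p_def using False fin(3) by auto
      show ?thesis
      proof (cases "\<exists>y \<in> extra. y \<le> 2 * p \<and> y \<notin> medium")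
        case True
        then obtain y where y: "y \<in> extra" "y \<le> 2 * p" "y \<notin> medium" by blast
        have "card centres \<le> card extra + 1"
        proof (rule combine)
          show "insert y medium \<subseteq> extra" using y(1) medium_extra by simp
          show "card tiny + card medium \<le> card (insert y medium)" using y(3) 2 fin(2) by simp
          show "z \<le> 2 * j" if "z \<in> insert y medium" "j \<in> large" for z j
            using that y(2) p(2)[OF that(2)] medium_low[of z j] by auto
        qed
        then show ?thesis by simp
      next
        case none: False
        then have ED: "E = 2" "D = 3" using one_tiny[OF tiny p(1)] by auto
        have "i \<in> tiny" using tiny by simp
        then have "i \<in> centres" "i = 1" using centreD(2)[of i] ED unfolding tiny_def by auto
        then have two: "2 \<notin> B" using centreD(5)[of i] by simp
        have "z \<notin> medium" for z
        proof
          assume "z \<in> medium"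
          then have "z \<in> centres" "z = 2" unfolding medium_def using ED by auto
          then show False using two centreD(1) by blast
        qed
        then have "medium = {}" by blast
        moreover have "2 \<le> 2 * p" using p(1) ED unfolding large_def by simp
        ultimately have ext: "2 \<notin> extra" using none by blast
        have sum: "card centres = 1 + card large" using split 2 \<open>medium = {}\<close> by simp

        show ?thesis
        proof (cases "2 \<le> card large")
          case True
          then show ?thesis using large_surplus[OF ED two ext] sum by simp
        next
          case False
          have "card large \<noteq> 0" using \<open>large \<noteq> {}\<close> fin(3) by simp
          then have one: "card large = 1" using False by simp
          have pc: "p \<in> centres" "3 \<le> p" using p(1) ED unfolding large_def by auto
          have m: "m = 2 * n - 3" using mE ED by simp
          have "4 \<le> n" using pc centreD(3)[OF pc(1)] by simp
          then have "2 * (n - 1) \<in> S"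
            using restricted_sumsetI[OF one_in m_in] m by (simp add: algebra_simps)
          then have "p \<noteq> n - 1" using centreD(4)[OF pc(1)] by auto
          then have "5 \<le> n" using pc centreD(3)[OF pc(1)] by simp
          moreover have "1 \<le> card extra" if "extra \<noteq> {}"
            using that finite_extra by (simp add: Suc_le_eq card_gt_0_iff)
          ultimately show ?thesis using sum one ED two by fastforce
        qed
      qed
    qed
  qed
qed

section \<open>The extremal sets\<close>

text \<open>
  Without extra elements, \<open>B\<close> is closed under subtraction of \<open>3\<close>, so it is an initial segment of each residue class modulo \<open>3\<close>,
  and the class of \<open>2\<close> is empty. Reflection about \<open>n - 1/2\<close> pairs the empty class with a full one and maps the
  third class to itself, exchanging elements and gaps; hence that class is cut exactly in the middle. The empty class
  cannot be mapped to itself, which excludes \<open>n \<equiv> 1\<close>.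
\<close>
lemma extremal_structure:
  assumes "E = 2" "D = 3" "2 \<notin> B" "extra = {}" "5 \<le> n"
  shows "(n mod 3 = 2 \<and> insert (2 * n) B =
        ({0..n - 2} \<inter> {x. [x = 0] (mod 3)}) \<union> ({1..2 * n} \<inter> {x. [x = 1] (mod 3)})) \<or>
      (n mod 3 = 0 \<and> insert (2 * n) B =
        ({0..2 * n} \<inter> {x. [x = 0] (mod 3)}) \<union> ({1..n - 2} \<inter> {x. [x = 1] (mod 3)}))"
proof -
  have m: "m = 2 * n - 3" using mE assms(1) by simp
  have "2 \<notin> extra" using assms(4) by simp
  then have top: "2 * n - 1 \<notin> S"
    using assms(2) below_D_notin[of 2] m unfolding extra_def by (simp add: assms(1))
  have refl: "x \<in> B \<longleftrightarrow> 2 * n - 1 - x \<notin> B" if "0 \<le> x" "x \<le> 2 * n - 1" for x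
    using reflect_top[OF top that] .
  have range: "0 \<le> x" "x \<le> 2 * n - 3" if "x \<in> B" for x using that B_sub m by auto
  have step': "x - 3 \<in> B" if "x \<in> B" "2 \<le> x" "x \<noteq> m" for x
    using extra_of_member[of x] that assms by auto
  \<comment> \<open>Closure fails to apply to m itself because m + m is not allowed; reflection reduces this case to 5.\<close>
  have "5 \<notin> B" using step'[of 5] assms m by auto
  then have "2 * n - 1 - 5 \<in> B" using refl[of 5] assms(5) by simp
  moreover have "2 * n - 1 - 5 = m - 3" using m by simp
  ultimately have "m - 3 \<in> B" by simp
  then have step: "x - 3 \<in> B" if "x \<in> B" "2 \<le> x" for x using step' that by blast
  have down: "x - 3 * int j \<in> B" if "x \<in> B" "0 \<le> x - 3 * int j" for x j
    using that
  proof (induction j)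
    case (Suc j)
    then have "x - 3 * int j - 3 \<in> B" by (intro step) auto
    then show ?case by (simp add: algebra_simps)
  qed simp
  have descend: "y \<in> B" if "x \<in> B" "0 \<le> y" "y \<le> x" "y mod 3 = x mod 3" for x y
  proof -
    have "3 * ((x - y) div 3) = x - y" "0 \<le> (x - y) div 3" using that by presburger+
    then have "x - 3 * int (nat ((x - y) div 3)) = y" by simp
    then show ?thesis using down[of x "nat ((x - y) div 3)"] that by simp
  qed
  have class2: "x \<notin> B" if "x mod 3 = 2" for x
  proof
    assume "x \<in> B"
    moreover from this have "2 \<le> x" using range(1)[of x] that by presburger
    ultimately show False using descend[of x 2] that assms(3) by simp
  qed
  have full: "x \<in> B" if "0 \<le> x" "x \<le> 2 * n - 1" "(2 * n - 1 - x) mod 3 = 2" for x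
    using refl[OF that(1,2)] class2[OF that(3)] by blast
  have low: "x \<in> B" if "0 \<le> x" "x \<le> n - 2" "x mod 3 = (2 * n - 1 - x) mod 3" for x
  proof (rule ccontr)
    assume "x \<notin> B"
    then have "2 * n - 1 - x \<in> B" using refl[of x] that assms(5) by simp
    then show False using descend[of "2 * n - 1 - x" x] that \<open>x \<notin> B\<close> by simp
  qed
  have high: "x \<notin> B" if x: "n - 2 < x" "x mod 3 = (2 * n - 1 - x) mod 3" "x mod 3 = (n - 2) mod 3" for x
  proof
    assume "x \<in> B"
    then have r: "0 \<le> x" "x \<le> 2 * n - 1" using range[of x] by auto
    have "3 dvd x - (n - 2)" using x(3) by (simp only: mod_eq_dvd_iff)
    then obtain t where "x - (n - 2) = 3 * t" ..
    moreover from this have "1 \<le> t" using x(1) by linarith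
    ultimately have "2 * n - 1 - x \<le> n - 2" by linarith
    moreover have "2 * n - 1 - (2 * n - 1 - x) = x" by simp
    ultimately have "2 * n - 1 - x \<in> B" using low[of "2 * n - 1 - x"] r x(2) by (metis diff_ge_0_iff_ge)
    then show False using refl[OF r] \<open>x \<in> B\<close> by blast
  qed
  have half: "x \<in> B \<longleftrightarrow> x \<le> n - 2"
    if "0 \<le> x" "x mod 3 = (2 * n - 1 - x) mod 3" "x mod 3 = (n - 2) mod 3" for x
    using low[OF that(1) _ that(2)] high[OF _ that(2,3)] by (meson not_less)
  have mem: "x \<in> insert (2 * n) B \<longleftrightarrow> x = 2 * n \<or> (0 \<le> x \<and> x \<le> 2 * n - 1 \<and> x \<in> B)" for x
  proof -
    have "x \<in> B \<Longrightarrow> 0 \<le> x \<and> x \<le> 2 * n - 1" using range[of x] by linarith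
    then show ?thesis by blast
  qed
  have bound: "x mod 3 = 0 \<or> x mod 3 = 1 \<or> x mod 3 = 2" for x :: int by presburger
  have not1: "n mod 3 \<noteq> 1"
  proof
    assume "n mod 3 = 1"
    then have "(2 * n - 1 - 2) mod 3 = 2" by presburger
    then show False using full[of 2] assms(3,5) by simp
  qed
  then consider "n mod 3 = 2" | "n mod 3 = 0" using bound[of n] by blast
  then show ?thesis
  proof cases
    case 1
    have "x \<in> insert (2 * n) B \<longleftrightarrow> (0 \<le> x \<and> x \<le> n - 2 \<and> x mod 3 = 0) \<or> (1 \<le> x \<and> x \<le> 2 * n \<and> x mod 3 = 1)" for x
    proof (cases "0 \<le> x \<and> x \<le> 2 * n - 1")
      case True
      consider "x mod 3 = 0" | "x mod 3 = 1" | "x mod 3 = 2" using bound[of x] by blast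
      then show ?thesis
      proof cases
        case c: 1
        then have "x mod 3 = (2 * n - 1 - x) mod 3" "x mod 3 = (n - 2) mod 3" using 1 by presburger+
        then show ?thesis unfolding mem using half[of x] True c by auto
      next
        case c: 2
        then have "(2 * n - 1 - x) mod 3 = 2" "1 \<le> x" using 1 True by presburger+
        then show ?thesis unfolding mem using full[of x] True c by auto
      next
        case c: 3
        then show ?thesis unfolding mem using class2[of x] True c by auto
      qed
    next
      case False
      have "(2 * n) mod 3 = 1" using 1 by presburger
      then show ?thesis unfolding mem using False assms(5) by auto
    qed
    then have "insert (2 * n) B =
        ({0..n - 2} \<inter> {x. [x = 0] (mod 3)}) \<union> ({1..2 * n} \<inter> {x. [x = 1] (mod 3)})"
      unfolding cong_def by (intro set_eqI) simp
    then show ?thesis using 1 by simp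
  next
    case 2
    have "x \<in> insert (2 * n) B \<longleftrightarrow> (0 \<le> x \<and> x \<le> 2 * n \<and> x mod 3 = 0) \<or> (1 \<le> x \<and> x \<le> n - 2 \<and> x mod 3 = 1)" for x
    proof (cases "0 \<le> x \<and> x \<le> 2 * n - 1")
      case True
      consider "x mod 3 = 0" | "x mod 3 = 1" | "x mod 3 = 2" using bound[of x] by blast
      then show ?thesis
      proof cases
        case c: 1
        then have "(2 * n - 1 - x) mod 3 = 2" using 2 by presburger
        then show ?thesis unfolding mem using full[of x] True c by auto
      next
        case c: 2
        then have "x mod 3 = (2 * n - 1 - x) mod 3" "x mod 3 = (n - 2) mod 3" "1 \<le> x"
          using 2 True by presburger+
        then show ?thesis unfolding mem using half[of x] True c by auto
      next
        case c: 3
        then show ?thesis unfolding mem using class2[of x] True c by auto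
      qed
    next
      case False
      have "(2 * n) mod 3 = 0" using 2 by presburger
      then show ?thesis unfolding mem using False assms(5) by auto
    qed
    then have "insert (2 * n) B =
        ({0..2 * n} \<inter> {x. [x = 0] (mod 3)}) \<union> ({1..n - 2} \<inter> {x. [x = 1] (mod 3)})"
      unfolding cong_def by (intro set_eqI) simp
    then show ?thesis using 2 by simp
  qed
qed

end

text \<open>
  A sum of two elements lies in the class \<open>0\<close>, \<open>1\<close> or \<open>2\<close> according to the number of summands from the class \<open>1\<close>;
  in the classes \<open>0\<close> and \<open>2\<close> both summands are in the same class, and the two extreme values would need equal summands.
\<close>
lemma card_sumset_two_classes:
  fixes u v :: int
  assumes "1 \<le> u" "1 \<le> v" "A \<subseteq> (\<lambda>x. 3 * x) ` {0..u} \<union> (\<lambda>x. 3 * x + 1) ` {0..v}"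
  shows "int (card (restricted_sumset A)) \<le> 3 * u + 3 * v - 1"
proof -
  let ?U = "(\<lambda>x. 3 * x) ` {1..2 * u - 1}"
  let ?V = "(\<lambda>x. 3 * x + 1) ` {0..u + v}"
  let ?W = "(\<lambda>x. 3 * x + 2) ` {1..2 * v - 1}"
  have "s \<in> ?U \<union> ?V \<union> ?W" if s: "s \<in> restricted_sumset A" for s
  proof -
    obtain x y where xy: "x \<in> A" "y \<in> A" "x < y" "s = x + y" using s by (rule restricted_sumsetE)
    have "x \<in> (\<lambda>x. 3 * x) ` {0..u} \<union> (\<lambda>x. 3 * x + 1) ` {0..v}"
      "y \<in> (\<lambda>x. 3 * x) ` {0..u} \<union> (\<lambda>x. 3 * x + 1) ` {0..v}"
      using xy(1,2) assms(3) by auto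
    then consider
        x' y' where "x = 3 * x'" "y = 3 * y'" "0 \<le> x'" "x' \<le> u" "0 \<le> y'" "y' \<le> u"
      | x' y' where "x = 3 * x'" "y = 3 * y' + 1" "0 \<le> x'" "x' \<le> u" "0 \<le> y'" "y' \<le> v"
      | x' y' where "x = 3 * x' + 1" "y = 3 * y'" "0 \<le> x'" "x' \<le> v" "0 \<le> y'" "y' \<le> u"
      | x' y' where "x = 3 * x' + 1" "y = 3 * y' + 1" "0 \<le> x'" "x' \<le> v" "0 \<le> y'" "y' \<le> v"
      by auto
    then show ?thesis
    proof cases
      case 1
      then have "s = 3 * (x' + y')" "x' + y' \<in> {1..2 * u - 1}" using xy by auto
      then show ?thesis by blast
    next
      case 2
      then have "s = 3 * (x' + y') + 1" "x' + y' \<in> {0..u + v}" using xy by auto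
      then show ?thesis by blast
    next
      case 3
      then have "s = 3 * (x' + y') + 1" "x' + y' \<in> {0..u + v}" using xy by auto
      then show ?thesis by blast
    next
      case 4
      then have "s = 3 * (x' + y') + 2" "x' + y' \<in> {1..2 * v - 1}" using xy by auto
      then show ?thesis by blast
    qed
  qed
  then have "card (restricted_sumset A) \<le> card (?U \<union> ?V \<union> ?W)" by (intro card_mono) auto
  also have "\<dots> \<le> card ?U + card ?V + card ?W"
    by (meson add_le_mono1 card_Un_le order_trans)
  also have "\<dots> \<le> card {1..2 * u - 1} + card {0..u + v} + card {1..2 * v - 1}"
    by (intro add_mono card_image_le) auto
  finally show ?thesis using assms(1,2) by simp
qed

lemma residue_class_subset:
  fixes c q w :: int
  assumes "q \<le> 3 * w + c"
  shows "{c..q} \<inter> {x. [x = c] (mod 3)} \<subseteq> (\<lambda>x. 3 * x + c) ` {0..w}"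
proof
  fix x assume "x \<in> {c..q} \<inter> {x. [x = c] (mod 3)}"
  then have x: "c \<le> x" "x \<le> 3 * w + c" "3 dvd x - c"
    using assms by (auto simp: cong_iff_dvd_diff)
  then obtain y where "x - c = 3 * y" by blast
  then have "x = 3 * y + c" "y \<in> {0..w}" using x by auto
  then show "x \<in> (\<lambda>x. 3 * x + c) ` {0..w}" by blast
qed

theorem theorem1p2:
  fixes k :: nat and a :: "nat \<Rightarrow> int" and A :: "int set"
  assumes "k \<ge> 3"
    and "A = a ` {0..k - 1}"
    and "strict_mono_on {0..k - 1} a"
    and "a 0 = 0"
    and "\<And>i. i \<in> {1..k - 2} \<Longrightarrow> a i < 2 * int i"
    and "a (k - 1) \<ge> 2 * int k - 2"
    and "Gcd A = 1"
  shows "int (card (restricted_sumset A)) \<ge> 3 * int k - 7 \<and>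
    (int (card (restricted_sumset A)) = 3 * int k - 7 \<longleftrightarrow>
      k \<ge> 6 \<and>
      (([k = 0] (mod 3) \<and>
          A = ({0..int k - 3} \<inter> {x. [x = 0] (mod 3)}) \<union>
              ({1..2 * int k - 2} \<inter> {x. [x = 1] (mod 3)}))
       \<or> ([k = 1] (mod 3) \<and>
          A = ({0..2 * int k - 2} \<inter> {x. [x = 0] (mod 3)}) \<union>
              ({1..int k - 3} \<inter> {x. [x = 1] (mod 3)}))))"
proof -
  let ?C1 = "[k = 0] (mod 3) \<and>
      A = ({0..int k - 3} \<inter> {x. [x = 0] (mod 3)}) \<union> ({1..2 * int k - 2} \<inter> {x. [x = 1] (mod 3)})"
  let ?C2 = "[k = 1] (mod 3) \<and>
      A = ({0..2 * int k - 2} \<inter> {x. [x = 0] (mod 3)}) \<union> ({1..int k - 3} \<inter> {x. [x = 1] (mod 3)})"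
  define n :: int where "n = int k - 1"
  have k_eq: "int k = n + 1" by (simp add: n_def)
  define m where "m = a (k - 2)"
  define B where "B = a ` {0..k - 2}"
  have less: "a i < a j" if "i < j" "j \<le> k - 1" for i j
    using assms(3) that by (auto simp: strict_mono_on_def)
  have le: "a i \<le> a j" if "i \<le> j" "j \<le> k - 1" for i j
    using less[of i j] that by (cases "i = j") auto
  have inj: "inj_on a {0..k - 1}" using assms(3) by (rule strict_mono_on_imp_inj_on)
  have a1: "a 1 = 1"
  proof -
    have "1 \<in> {1..k - 2}" "1 \<le> k - 1" using assms(1) by auto
    then show ?thesis using less[of 0 1] assms(4) assms(5)[of 1] by simp
  qed
  have "k - 2 \<in> {1..k - 2}" using assms(1) by auto
  then have m_le: "m \<le> 2 * n - 3" using assms(1) assms(5)[of "k - 2"] unfolding m_def n_def by simp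
  have A_eq: "A = insert (a (k - 1)) B"
  proof -
    have "{0..k - 1} = insert (k - 1) {0..k - 2}" using assms(1) by auto
    then show ?thesis unfolding assms(2) B_def by simp
  qed
  interpret half_dense B n m "a (k - 1) - m" "2 * n - 1 - m"
  proof
    show "B \<subseteq> {0..m}" unfolding B_def m_def using le[of 0] le[of _ "k - 2"] assms(1,4) by auto
    show "m \<in> B" "0 \<in> B" "1 \<in> B"
      unfolding B_def m_def using assms(1,4) a1 by (auto simp: image_iff intro: bexI[of _ 0] bexI[of _ 1])
    show "int (card B) = n"
      unfolding B_def n_def using assms(1) inj
      by (subst card_image) (auto intro: inj_on_subset)
    show "m + (2 * n - 1 - m) = 2 * n - 1" by simp
    show "2 \<le> 2 * n - 1 - m" using m_le by simp
    show "2 * n - 1 - m + 1 \<le> a (k - 1) - m" using assms(6) unfolding n_def by simp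
    show "x + 1 \<le> 2 * int (card (B \<inter> {0..<x}))" if x: "1 \<le> x" "x \<le> 2 * n - 1" for x
    proof -
      \<comment> \<open>The elements a 0, ..., a j lie below x.\<close>
      define j where "j = nat (x div 2)"
      have j: "2 * int j \<le> x" "x \<le> 2 * int j + 1" using x unfolding j_def by auto
      then have "2 * int j \<le> 2 * int k - 3" using x unfolding n_def by (simp add: algebra_simps)
      then have jk: "j \<le> k - 2" by linarith
      have "a i \<in> B \<inter> {0..<x}" if "i \<le> j" for i
      proof -
        have "0 \<le> a i" using le[of 0 i] that jk assms(1,4) by simp
        moreover have "a i < x"
        proof (cases "i = 0")
          case True
          then show ?thesis using assms(4) x by simp
        next
          case False
          then have "a i < 2 * int i" using that jk by (intro assms(5)) auto
          then show ?thesis using that j by linarith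
        qed
        ultimately show ?thesis unfolding B_def using that jk by auto
      qed
      then have "card (a ` {0..j}) \<le> card (B \<inter> {0..<x})" by (intro card_mono) auto
      moreover have "card (a ` {0..j}) = j + 1"
        using inj jk assms(1) by (subst card_image) (auto intro: inj_on_subset)
      ultimately show ?thesis using j by simp
    qed
  qed
  have card_eq: "int (card (restricted_sumset A)) = 3 * n - 2 - int (card centres) + int (card extra)"
    using card_sumset_insert A_eq by simp
  have ge: "3 * int k - 7 \<le> int (card (restricted_sumset A))"
    using centres_extra card_eq k_eq by linarith
  have extremal: "6 \<le> k \<and> (?C1 \<or> ?C2)"
    if eq: "int (card (restricted_sumset A)) = 3 * int k - 7"
  proof -
    have "card centres = card extra + 2" using eq card_eq k_eq by linarith
    then have ext: "extra = {}" "2 * n - 1 - m = 2" "a (k - 1) - m = 3" "2 \<notin> B" "5 \<le> n"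
      using centres_extra by auto
    then have "a (k - 1) = 2 * n" by simp
    then have A: "A = insert (2 * n) B" using A_eq by simp
    have nk: "n - 2 = int k - 3" "2 * n = 2 * int k - 2" unfolding n_def by auto
    have k0: "[k = 0] (mod 3)" if "n mod 3 = 2" using that unfolding n_def cong_def by presburger
    have k1: "[k = 1] (mod 3)" if "n mod 3 = 0" using that unfolding n_def cong_def by presburger
    have "6 \<le> k" using ext(5) k_eq by linarith
    moreover note extremal_structure[OF ext(2,3,4,1,5), folded A, unfolded nk]
    then have "?C1 \<or> ?C2"
      by (rule disj_forward)
        (erule conjE, rule conjI, erule k0, assumption, erule conjE, rule conjI, erule k1, assumption)
    ultimately show ?thesis by (rule conjI)
  qed
  have le_of_case1: "int (card (restricted_sumset A)) \<le> 3 * int k - 7"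
    if "6 \<le> k" "?C1"
  proof -
    note A = conjunct2[OF that(2)]
    define r where "r = (int k - 3) div 3"
    have "k mod 3 = 0" using conjunct1[OF that(2)] unfolding cong_def by simp
    then have r: "int k = 3 * r + 3" "1 \<le> r" using that(1) unfolding r_def by presburger+
    have "A \<subseteq> (\<lambda>x. 3 * x) ` {0..r} \<union> (\<lambda>x. 3 * x + 1) ` {0..2 * r + 1}"
      unfolding A using residue_class_subset[of _ "r" 0] residue_class_subset[of _ "2 * r + 1" 1] r(1)
      by (intro Un_mono) auto
    then show ?thesis using card_sumset_two_classes[of r "2 * r + 1" A] r by simp
  qed
  have le_of_case2: "int (card (restricted_sumset A)) \<le> 3 * int k - 7"
    if "6 \<le> k" "?C2"
  proof -
    note A = conjunct2[OF that(2)]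
    define r where "r = (int k - 1) div 3"
    have "k mod 3 = 1" using conjunct1[OF that(2)] unfolding cong_def by simp
    then have r: "int k = 3 * r + 1" "2 \<le> r" using that(1) unfolding r_def by presburger+
    have "A \<subseteq> (\<lambda>x. 3 * x) ` {0..2 * r} \<union> (\<lambda>x. 3 * x + 1) ` {0..r - 1}"
      unfolding A using residue_class_subset[of _ "2 * r" 0] residue_class_subset[of _ "r - 1" 1] r(1)
      by (intro Un_mono) auto
    then show ?thesis using card_sumset_two_classes[of "2 * r" "r - 1" A] r by simp
  qed
  show ?thesis
  proof (intro conjI[OF ge] iffI)
    assume "int (card (restricted_sumset A)) = 3 * int k - 7"
    then show "6 \<le> k \<and> (?C1 \<or> ?C2)" by (rule extremal)
  next
    assume shape: "6 \<le> k \<and> (?C1 \<or> ?C2)"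
    have "int (card (restricted_sumset A)) \<le> 3 * int k - 7"
      using conjunct2[OF shape]
      by (rule disjE) (rule le_of_case1[OF conjunct1[OF shape]] le_of_case2[OF conjunct1[OF shape]], assumption)+
    then show "int (card (restricted_sumset A)) = 3 * int k - 7" using ge by (rule order_antisym)
  qed
qed

end
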